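(* For matrix-vector multiplication, the projective distribution has the minimum communication complexity among the weak Cartesian distributions.
   Context: Block setting. There are $n$ processes, labelled by $N=\{0,1,\dots,n-1\}$. A square $m\times m$ matrix $A$ (general, potentially dense; no use is made of sparsity) is viewed as an $n\times n$ array of blocks $A_{i,j}$, $i,j\in N$, and the vectors $x$ and $y$ are split conformally into blocks $X_j$ and $Y_i$. A data distribution allocates the blocks of $A$ to processes; process $i$ owns $X_i$ and $Y_i$. In computing $y=Ax$, matrix blocks are not moved. Process $k$ computes $A_{i,j}X_j$ for each block $A_{i,j}$ allocated to it, so it needs the input block $X_j$ and produces a partial sum for $Y_i$, which is sent to the owner of $Y_i$. Weak Cartesian distribution ($n$-process): a distribution such that (1) $A$ is viewed as a blocked matrix with $n\times n$ square blocks, each with $\lfloor m/n\rfloor$ rows and columns, the last block row and last block column accounting for all extra rows and columns when $m$ is not a multiple of $n$; (2) the diagonal block $A_{i,i}$ is allocated to process $i$; (3) each process is allocated $n-1$ other blocks apart from its diagonal block; (4) each block is allocated to a unique process. Communication complexity: it is counted per process, in vector blocks. If the blocks allocated to a process lie in $r$ distinct block rows (it has $r$ row sub-blocks) and $c$ distinct block columns (it has $c$ column sub-blocks), the communication complexity at that process is $r+c$: $c$ communications to receive input vector blocks and $r$ communications to send partial sums of output vector blocks. Projective distribution: let $p$ be a prime power and $n=p^2+p+1$. Label both the $n$ points and the $n$ lines of the two-dimensional projective space over the field with $p$ elements by $N$, and let $c(k)\subset N$ be the set of the $p+1$ points on line $k$. Allocate $A_{i,i}$ to process $i$ for each $i$;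 and for every process $k$ and every pair of distinct points $i,j\in c(k)$, allocate $A_{i,j}$ and $A_{j,i}$ to process $k$. The comparison is with weak Cartesian distributions on the same number $n$ of processes.
   Formalization: Minimality is proved for labellings in which point k lies on line k for every k (such labellings are proved to exist); otherwise the diagonal block raises the cost of some process to 2p+4, above the attainable 2p+2, and the claim fails. *)

theory Defs
  imports "HOL-Analysis.Analysis" "HOL-Number_Theory.Number_Theory"
begin

text \<open>
  For \<open>n\<close> processes \<open>{..<n}\<close> and an \<open>m \<times> m\<close> matrix \<open>A\<close>, the rows and the columns \<open>{..<m}\<close>
  are both cut into the index ranges \<open>idx d i\<close> for \<open>i < n\<close>. The pair \<open>(i, j)\<close> denotes the
  block of \<open>A\<close> with rows \<open>idx d i\<close> and columns \<open>idx d j\<close>, and \<open>alloc d k\<close> is the set of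
  blocks allocated to process \<open>k\<close>. Only the values at \<open>i, k < n\<close> are meaningful.
\<close>

record block_dist =
  idx :: "nat \<Rightarrow> nat set"
  alloc :: "nat \<Rightarrow> (nat \<times> nat) set"

definition block_range :: "nat \<Rightarrow> nat \<Rightarrow> nat \<Rightarrow> nat set" where
  "block_range m n i =
     {i * (m div n) ..< (if i = n - 1 then m else (i + 1) * (m div n))}"

definition weak_cartesian :: "nat \<Rightarrow> nat \<Rightarrow> block_dist \<Rightarrow> bool" where
  "weak_cartesian m n d \<longleftrightarrow>
     (\<forall>i<n. idx d i = block_range m n i) \<and>
     (\<forall>k<n. alloc d k \<subseteq> {..<n} \<times> {..<n}) \<and>
     (\<forall>i<n. (i, i) \<in> alloc d i) \<and>
     (\<forall>k<n. card (alloc d k - {(k, k)}) = n - 1) \<and>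
     (\<forall>i<n. \<forall>j<n. \<exists>!k. k < n \<and> (i, j) \<in> alloc d k)"

text \<open>
  The cost at process \<open>k\<close>, in vector blocks: one communication for each block row and one
  for each block column met by its blocks, the diagonal block \<open>(k, k)\<close> included.
\<close>

definition comm :: "block_dist \<Rightarrow> nat \<Rightarrow> nat" where
  "comm d k = card (fst ` alloc d k) + card (snd ` alloc d k)"

text \<open>
  The cost is counted per process, so a minimal distribution is required to cost, at each of
  its processes, no more than any weak Cartesian distribution does at any process. This
  implies minimality of the largest cost and of the total cost over the processes.
\<close>

definition min_comm :: "nat \<Rightarrow> nat \<Rightarrow> block_dist \<Rightarrow> bool" where
  "min_comm m n d \<longleftrightarrow>
     (\<forall>d'. weak_cartesian m n d' \<longrightarrow> (\<forall>k<n. \<forall>l<n. comm d k \<le> comm d' l))"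


definition proj_points :: "('f::field ^ 3) set set" where
  "proj_points = {U. vec.subspace U \<and> vec.dim U = 1}"

definition proj_lines :: "('f::field ^ 3) set set" where
  "proj_lines = {U. vec.subspace U \<and> vec.dim U = 2}"

definition proj_labelling ::
  "nat \<Rightarrow> (nat \<Rightarrow> ('f::field ^ 3) set) \<Rightarrow> (nat \<Rightarrow> ('f ^ 3) set) \<Rightarrow> bool" where
  "proj_labelling n P L \<longleftrightarrow>
     bij_betw P {..<n} proj_points \<and> bij_betw L {..<n} proj_lines"

definition points_on ::
  "nat \<Rightarrow> (nat \<Rightarrow> ('f::field ^ 3) set) \<Rightarrow> (nat \<Rightarrow> ('f ^ 3) set) \<Rightarrow> nat \<Rightarrow> nat set" where
  "points_on n P L k = {i. i < n \<and> P i \<subseteq> L k}"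

definition projective_dist ::
  "nat \<Rightarrow> nat \<Rightarrow> (nat \<Rightarrow> ('f::field ^ 3) set) \<Rightarrow> (nat \<Rightarrow> ('f ^ 3) set) \<Rightarrow> block_dist" where
  "projective_dist m n P L =
     \<lparr> idx = block_range m n,
       alloc = (\<lambda>k. insert (k, k)
         {(i, j). i \<in> points_on n P L k \<and> j \<in> points_on n P L k \<and> i \<noteq> j}) \<rparr>"

text \<open>
  The diagonal block of process \<open>k\<close> stays within the block rows and columns of the points on
  line \<open>k\<close> iff the point labelled \<open>k\<close> lies on the line labelled \<open>k\<close>. Otherwise it costs
  process \<open>k\<close> one more block row and one more block column, and minimality fails.
\<close>

definition incident_labelling ::
  "nat \<Rightarrow> (nat \<Rightarrow> ('f::field ^ 3) set) \<Rightarrow> (nat \<Rightarrow> ('f ^ 3) set) \<Rightarrow> bool" where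
  "incident_labelling n P L \<longleftrightarrow> (\<forall>k<n. k \<in> points_on n P L k)"

end

theory Submission
  imports Defs
begin

text \<open>
  A process owning \<open>n = q\<^sup>2 + q + 1\<close> blocks that meet \<open>r\<close> block rows and \<open>c\<close> block columns has
  \<open>r * c \<ge> n > q * (q + 1)\<close>, which forces \<open>r + c \<ge> 2 * (q + 1)\<close>. In an incident
  projective distribution the blocks of a process lie in the square array on the \<open>q + 1\<close> points
  of its line, so this bound is attained.

  An incident labelling is a perfect matching between points and lines. In affine coordinates, the
  point \<open>(a, b)\<close> is matched with the line of slope \<open>a\<close> through it if \<open>b \<noteq> 0\<close>, and with the vertical
  line through it if \<open>b = 0\<close>. The point at infinity of slope \<open>s\<close> is matched with \<open>y = s * x - s\<^sup>2\<close>,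
  the line of slope \<open>s\<close> through \<open>(s, 0)\<close> that the second rule has freed. The vertical point at
  infinity is matched with the line at infinity.
\<close>

section \<open>Counting points and lines\<close>

text \<open>Induction on \<open>B\<close>: as \<open>a\<close> lies outside the span of
  \<open>B\<close>, every vector of the larger span is \<open>k *s a + s\<close> for exactly one
  scalar \<open>k\<close> and one \<open>s\<close> in \<open>vec.span B\<close>, so each basis
  vector multiplies the count by \<open>CARD('f)\<close>.\<close>

lemma card_span_independent:
  fixes B :: "('f::{field,finite} ^ 'n) set"
  assumes "finite B" "vec.independent B"
  shows "card (vec.span B) = CARD('f) ^ card B"
  using assms
proof (induction B rule: finite_induct)
  case empty
  then show ?case by simp
next
  case (insert a B)
  have ind: "vec.independent B" and a: "a \<notin> vec.span B"
    using insert by (auto simp: vec.independent_insert)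
  let ?f = "\<lambda>(k::'f, s). k *s a + s"
  have "inj_on ?f (UNIV \<times> vec.span B)"
  proof (rule inj_onI, clarify)
    fix k s k' s'
    assume s: "s \<in> vec.span B" "s' \<in> vec.span B" and eq: "k *s a + s = k' *s a + s'"
    have d: "(k - k') *s a = s' - s"
      using eq by (simp add: vec.scale_left_diff_distrib algebra_simps)
    have "k = k'"
    proof (rule ccontr)
      assume "k \<noteq> k'"
      then have "inverse (k - k') *s ((k - k') *s a) = a"
        by (simp only: vec.scale_scale) simp
      then have "a = inverse (k - k') *s (s' - s)"
        by (simp only: d)
      then show False
        using a s by (metis vec.span_diff vec.span_scale)
    qed
    with eq show "k = k' \<and> s = s'" by simp
  qed
  moreover have "?f ` (UNIV \<times> vec.span B) = vec.span (insert a B)"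
  proof
    show "?f ` (UNIV \<times> vec.span B) \<subseteq> vec.span (insert a B)"
      by (auto intro!: vec.span_add vec.span_scale
          intro: vec.span_base subsetD[OF vec.span_mono[OF subset_insertI]])
    show "vec.span (insert a B) \<subseteq> ?f ` (UNIV \<times> vec.span B)"
    proof
      fix x assume "x \<in> vec.span (insert a B)"
      then obtain k where "x - k *s a \<in> vec.span B"
        unfolding vec.span_insert by blast
      then show "x \<in> ?f ` (UNIV \<times> vec.span B)"
        by (intro image_eqI[of _ _ "(k, x - k *s a)"]) auto
    qed
  qed
  ultimately have "card (vec.span (insert a B)) = card ((UNIV :: 'f set) \<times> vec.span B)"
    by (metis card_image)
  then show ?case
    using insert ind by (simp add: card_cartesian_product)
qed

lemma card_subspace:
  fixes W :: "('f::{field,finite} ^ 'n) set"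
  assumes "vec.subspace W"
  shows "card W = CARD('f) ^ vec.dim W"
proof -
  obtain B where B: "B \<subseteq> W" "vec.independent B" "W \<subseteq> vec.span B" "card B = vec.dim W"
    by (rule vec.basis_exists)
  then have "vec.span B = W"
    using assms vec.span_minimal by blast
  then show ?thesis
    using card_span_independent[of B] B vec.finiteI_independent by auto
qed

lemma proj_point_eq_span:
  assumes "U \<in> proj_points" "v \<in> U" "v \<noteq> 0"
  shows "U = vec.span {v}"
proof (rule sym, rule vec.subspace_dim_equal)
  show "vec.span {v} \<subseteq> U"
    using assms by (intro vec.span_minimal) (auto simp: proj_points_def)
qed (use assms in \<open>auto simp: proj_points_def\<close>)

lemma span_in_proj_points: "v \<noteq> 0 \<Longrightarrow> vec.span {v} \<in> proj_points"
  by (simp add: proj_points_def)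

lemma proj_point_obtain:
  assumes "U \<in> proj_points"
  obtains v where "v \<noteq> 0" "U = vec.span {v}"
proof -
  have "\<not> U \<subseteq> {0}"
    using assms by (auto simp: proj_points_def simp flip: vec.dim_eq_0)
  then show ?thesis
    using that proj_point_eq_span[OF assms] by blast
qed

text \<open>The points inside \<open>W\<close> partition its nonzero vectors into classes of size
  \<open>CARD('f) - 1\<close>. The whole space and the planes are the two cases used later.\<close>

lemma proj_points_in_subspace:
  fixes W :: "('f::{field,finite} ^ 3) set"
  assumes W: "vec.subspace W"
  shows "card {U \<in> proj_points. U \<subseteq> W} * (CARD('f) - 1) = CARD('f) ^ vec.dim W - 1"
proof -
  let ?I = "{U \<in> proj_points. U \<subseteq> W}"
  have Un: "W - {0} = (\<Union>U\<in>?I. U - {0})"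
  proof
    show "W - {0} \<subseteq> (\<Union>U\<in>?I. U - {0})"
    proof
      fix v assume "v \<in> W - {0}"
      then have "vec.span {v} \<in> ?I" "v \<in> vec.span {v} - {0}"
        using W by (auto intro: span_in_proj_points vec.span_base
            simp del: vec.span_singleton dest: subsetD[OF vec.span_minimal, rotated -1])
      then show "v \<in> (\<Union>U\<in>?I. U - {0})" by blast
    qed
  qed auto
  have "card (\<Union>U\<in>?I. U - {0}) = (\<Sum>U\<in>?I. card (U - {0}))"
  proof (rule card_UN_disjoint)
    show "\<forall>U\<in>?I. \<forall>V\<in>?I. U \<noteq> V \<longrightarrow> (U - {0}) \<inter> (V - {0}) = {}"
      using proj_point_eq_span by blast
  qed auto
  also have "\<dots> = (\<Sum>U\<in>?I. CARD('f) - 1)"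
  proof (rule sum.cong)
    fix U assume "U \<in> ?I"
    then have "vec.subspace U" "vec.dim U = 1"
      by (auto simp: proj_points_def)
    then show "card (U - {0}) = CARD('f) - 1"
      using card_subspace[of U] vec.subspace_0[of U] by simp
  qed simp
  finally have "card (W - {0}) = card ?I * (CARD('f) - 1)"
    unfolding Un by simp
  then show ?thesis
    using card_subspace[OF W] vec.subspace_0[OF W] by simp
qed

lemma card_field_ge_2: "CARD('f::{field,finite}) \<ge> 2"
  using card_mono[of "UNIV :: 'f set" "{0, 1}"] by simp

lemma card_proj_points:
  "card (proj_points :: ('f::{field,finite} ^ 3) set set) = CARD('f)\<^sup>2 + CARD('f) + 1"
proof -
  \<comment> \<open>Writing the field size as \<open>Suc r\<close> removes truncated subtraction,
    and \<open>r > 0\<close> allows cancelling the factor \<open>r\<close>.\<close>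
  obtain r where r: "CARD('f) = Suc r" "r > 0"
    using card_field_ge_2[where 'f='f] by (cases "CARD('f)") auto
  have "card (proj_points :: ('f ^ 3) set set) * r = Suc r ^ 3 - 1"
    using proj_points_in_subspace[of "UNIV :: ('f ^ 3) set"] r
    by (simp add: vec_dim_card del: vec.dim_UNIV)
  also have "\<dots> = ((Suc r)\<^sup>2 + Suc r + 1) * r"
    by (simp add: power2_eq_square power3_eq_cube algebra_simps)
  finally show ?thesis
    using r by (simp only: mult_cancel2) simp
qed

lemma card_points_in_line:
  fixes W :: "('f::{field,finite} ^ 3) set"
  assumes "W \<in> proj_lines"
  shows "card {U \<in> proj_points. U \<subseteq> W} = CARD('f) + 1"
proof -
  obtain r where r: "CARD('f) = Suc r" "r > 0"
    using card_field_ge_2[where 'f='f] by (cases "CARD('f)") auto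
  have "card {U \<in> proj_points. U \<subseteq> W} * r = (Suc r)\<^sup>2 - 1"
    using proj_points_in_subspace[of W] r assms by (simp add: proj_lines_def)
  also have "\<dots> = (Suc r + 1) * r"
    by (simp add: power2_eq_square algebra_simps)
  finally show ?thesis
    using r by (simp only: mult_cancel2) simp
qed

text \<open>Representatives of two distinct points are independent, so they span a plane; any line
  containing both points contains this plane and has the same dimension.\<close>

lemma unique_line_through_points:
  assumes "U \<in> proj_points" "V \<in> proj_points" "U \<noteq> V"
  shows "\<exists>!W. W \<in> proj_lines \<and> U \<subseteq> W \<and> V \<subseteq> W"
proof -
  obtain u v where u: "u \<noteq> 0" "U = vec.span {u}" and v: "v \<noteq> 0" "V = vec.span {v}"
    using assms proj_point_obtain by metis
  have "u \<notin> V"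
    using proj_point_eq_span[OF assms(2)] u assms(3) by blast
  then have dim: "vec.dim {u, v} = 2"
    using v by (simp add: vec.dim_insert del: vec.span_singleton)
  show ?thesis
  proof (intro ex1I conjI)
    show "vec.span {u, v} \<in> proj_lines"
      using dim by (simp add: proj_lines_def del: vec.span_singleton)
    show "U \<subseteq> vec.span {u, v}" "V \<subseteq> vec.span {u, v}"
      unfolding u v by (intro vec.span_mono, simp)+
    fix W assume W: "W \<in> proj_lines \<and> U \<subseteq> W \<and> V \<subseteq> W"
    then have "u \<in> W" "v \<in> W"
      unfolding u v using vec.span_superset by blast+
    then have "vec.span {u, v} \<subseteq> W"
      using W by (intro vec.span_minimal) (auto simp: proj_lines_def)
    then show "W = vec.span {u, v}"
      using W dim by (intro vec.subspace_dim_equal[symmetric]) (auto simp: proj_lines_def)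
  qed
qed

lemma card_distinct_pairs:
  assumes "finite S"
  shows "card {(x, y). x \<in> S \<and> y \<in> S \<and> x \<noteq> y} = card S * (card S - 1)"
proof -
  have "{(x, y). x \<in> S \<and> y \<in> S \<and> x \<noteq> y} = Sigma S (\<lambda>x. S - {x})"
    by auto
  then show ?thesis
    using assms by simp
qed

text \<open>Double counting of ordered pairs of distinct points: each pair lies on exactly one line,
  and each line carries \<open>(q + 1) * q\<close> of them.\<close>

lemma card_proj_lines:
  "card (proj_lines :: ('f::{field,finite} ^ 3) set set) = CARD('f)\<^sup>2 + CARD('f) + 1"
proof -
  let ?q = "CARD('f)"
  let ?pairs = "\<lambda>S. {(U, V). U \<in> S \<and> V \<in> S \<and> U \<noteq> V}"
  let ?on = "\<lambda>W :: ('f ^ 3) set. {U \<in> proj_points. U \<subseteq> W}"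
  have "?pairs (proj_points :: ('f ^ 3) set set) = (\<Union>W\<in>proj_lines. ?pairs (?on W))"
  proof
    show "?pairs (proj_points :: ('f ^ 3) set set) \<subseteq> (\<Union>W\<in>proj_lines. ?pairs (?on W))"
    proof clarify
      fix U V :: "('f ^ 3) set"
      assume UV: "U \<in> proj_points" "V \<in> proj_points" "U \<noteq> V"
      then obtain W where "W \<in> proj_lines" "U \<subseteq> W" "V \<subseteq> W"
        using unique_line_through_points by metis
      with UV show "(U, V) \<in> (\<Union>W\<in>proj_lines. ?pairs (?on W))"
        by blast
    qed
  qed auto
  moreover have "card (\<Union>W\<in>(proj_lines :: ('f ^ 3) set set). ?pairs (?on W))
      = (\<Sum>W\<in>(proj_lines :: ('f ^ 3) set set). card (?pairs (?on W)))"
  proof (rule card_UN_disjoint)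
    show "\<forall>W\<in>(proj_lines :: ('f ^ 3) set set). \<forall>W'\<in>proj_lines.
        W \<noteq> W' \<longrightarrow> ?pairs (?on W) \<inter> ?pairs (?on W') = {}"
    proof (clarify, rule equals0I, clarify)
      fix W W' U V :: "('f ^ 3) set"
      assume "W \<in> proj_lines" "W' \<in> proj_lines" "W \<noteq> W'" "U \<in> proj_points" "V \<in> proj_points"
        "U \<subseteq> W" "V \<subseteq> W" "U \<subseteq> W'" "V \<subseteq> W'" "U \<noteq> V"
      then show False
        using unique_line_through_points[of U V] by metis
    qed
  qed auto
  ultimately have "card (?pairs (proj_points :: ('f ^ 3) set set))
      = (\<Sum>W\<in>(proj_lines :: ('f ^ 3) set set). card (?pairs (?on W)))"
    by simp
  also have "\<dots> = (\<Sum>W\<in>(proj_lines :: ('f ^ 3) set set). (?q + 1) * ?q)"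
  proof (rule sum.cong)
    fix W :: "('f ^ 3) set" assume "W \<in> proj_lines"
    then show "card (?pairs (?on W)) = (?q + 1) * ?q"
      using card_distinct_pairs[of "?on W"] by (simp add: card_points_in_line)
  qed simp
  finally have "(?q\<^sup>2 + ?q + 1) * ((?q + 1) * ?q)
      = card (proj_lines :: ('f ^ 3) set set) * ((?q + 1) * ?q)"
    by (simp add: card_distinct_pairs card_proj_points power2_eq_square algebra_simps)
  then show ?thesis
    by (simp only: mult_cancel2) simp
qed

section \<open>An incident labelling\<close>

text \<open>The kernel of a linear form, so that a line, like a point, can be given by a single
  vector.\<close>

definition normal_line :: "'f::field ^ 3 \<Rightarrow> ('f ^ 3) set" where
  "normal_line u = {x. u$1 * x$1 + u$2 * x$2 + u$3 * x$3 = 0}"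

lemma normal_line_in_proj_lines:
  fixes u :: "'f::field ^ 3"
  assumes "u \<noteq> 0"
  shows "normal_line u \<in> proj_lines"
proof -
  have sub: "vec.subspace (normal_line u)"
    unfolding vec.subspace_def normal_line_def
  proof (intro conjI ballI allI; clarsimp)
    fix x y :: "'f ^ 3"
    assume "u$1 * x$1 + u$2 * x$2 + u$3 * x$3 = 0" "u$1 * y$1 + u$2 * y$2 + u$3 * y$3 = 0"
    moreover have "u$1 * (x$1 + y$1) + u$2 * (x$2 + y$2) + u$3 * (x$3 + y$3)
        = (u$1 * x$1 + u$2 * x$2 + u$3 * x$3) + (u$1 * y$1 + u$2 * y$2 + u$3 * y$3)"
      by (simp add: algebra_simps)
    ultimately show "u$1 * (x$1 + y$1) + u$2 * (x$2 + y$2) + u$3 * (x$3 + y$3) = 0"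
      by simp
  next
    fix c :: 'f and x :: "'f ^ 3"
    assume "u$1 * x$1 + u$2 * x$2 + u$3 * x$3 = 0"
    moreover have "u$1 * (c * x$1) + u$2 * (c * x$2) + u$3 * (c * x$3)
        = c * (u$1 * x$1 + u$2 * x$2 + u$3 * x$3)"
      by (simp add: algebra_simps)
    ultimately show "u$1 * (c * x$1) + u$2 * (c * x$2) + u$3 * (c * x$3) = 0"
      by simp
  qed
  obtain e :: "'f ^ 3" where e: "u$1 * e$1 + u$2 * e$2 + u$3 * e$3 = 1"
  proof -
    obtain i where i: "u $ i \<noteq> 0"
      using assms by (auto simp: vec_eq_iff)
    \<comment> \<open>A multiple of a coordinate vector at which the form does not vanish, scaled to
      give the value 1.\<close>
    show ?thesis
      using i exhaust_3[of i] that[of "axis i (inverse (u $ i))"] by (auto simp: axis_def)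
  qed
  then have e_notin: "e \<notin> normal_line u"
    by (simp add: normal_line_def)
  have "x \<in> vec.span (insert e (normal_line u))" for x
  proof -
    let ?s = "u$1 * x$1 + u$2 * x$2 + u$3 * x$3"
    have "u$1 * (x$1 - k * e$1) + u$2 * (x$2 - k * e$2) + u$3 * (x$3 - k * e$3)
        = ?s - k * (u$1 * e$1 + u$2 * e$2 + u$3 * e$3)" for k
      by (simp add: algebra_simps)
    \<comment> \<open>The form is 1 at \<open>e\<close>, so subtracting \<open>?s *s e\<close> from
      \<open>x\<close> moves it into the kernel. Thus \<open>e\<close> and the kernel span the
      space, and the kernel has dimension 3 - 1.\<close>
    from this[of ?s] have "x - ?s *s e \<in> normal_line u"
      unfolding normal_line_def mem_Collect_eq vector_minus_component vector_smult_component e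
      by simp
    then show ?thesis
      unfolding vec.span_insert using vec.span_base by blast
  qed
  then have "vec.span (insert e (normal_line u)) = UNIV"
    by blast
  then have "vec.dim (insert e (normal_line u)) = 3"
    using vec.dim_span[of "insert e (normal_line u)"]
    by (simp add: vec_dim_card del: vec.dim_UNIV vec.dim_span)
  moreover have "e \<notin> vec.span (normal_line u)"
    using e_notin sub by (simp add: vec.span_eq_iff[THEN iffD2])
  ultimately show ?thesis
    using sub by (simp add: vec.dim_insert proj_lines_def)
qed

text \<open>The 2 x 2 minors of \<open>u\<close> and \<open>v\<close> vanish, which is
  proportionality without a scalar. Each minor is \<open>v\<close> evaluated, up to sign, on a
  vector visibly orthogonal to \<open>u\<close>.\<close>

lemma normal_line_eqD:
  assumes "normal_line u = normal_line v"
  shows "u$1 * v$2 = u$2 * v$1" "u$1 * v$3 = u$3 * v$1" "u$2 * v$3 = u$3 * v$2"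
proof -
  have *: "x \<in> normal_line u \<Longrightarrow> x \<in> normal_line v" for x
    using assms by simp
  show "u$1 * v$2 = u$2 * v$1"
    using *[of "vector [u$2, - u$1, 0]"] by (simp add: normal_line_def algebra_simps)
  show "u$1 * v$3 = u$3 * v$1"
    using *[of "vector [u$3, 0, - u$1]"] by (simp add: normal_line_def algebra_simps)
  show "u$2 * v$3 = u$3 * v$2"
    using *[of "vector [0, u$3, - u$2]"] by (simp add: normal_line_def algebra_simps)
qed

text \<open>
  \<open>Inl (a, b)\<close> stands for an affine point, \<open>Inr (Some s)\<close> for the point at infinity of slope \<open>s\<close>,
  and \<open>Inr None\<close> for the vertical point at infinity. The normal vector \<open>(c, s, -1)\<close> is that of
  the line \<open>y = s * x + c\<close>.
\<close>

fun point_vec :: "('f \<times> 'f) + 'f option \<Rightarrow> 'f::field ^ 3" where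
  "point_vec (Inl (a, b)) = vector [1, a, b]"
| "point_vec (Inr (Some s)) = vector [0, 1, s]"
| "point_vec (Inr None) = vector [0, 0, 1]"

fun matched_normal :: "('f \<times> 'f) + 'f option \<Rightarrow> 'f::field ^ 3" where
  "matched_normal (Inl (a, b)) = (if b = 0 then vector [a, -1, 0] else vector [b - a * a, a, -1])"
| "matched_normal (Inr (Some s)) = vector [- (s * s), s, -1]"
| "matched_normal (Inr None) = vector [1, 0, 0]"

lemma point_vec_nonzero: "point_vec t \<noteq> 0"
  by (cases t rule: point_vec.cases) (simp_all add: vec_eq_iff forall_3)

lemma matched_normal_nonzero: "matched_normal t \<noteq> 0"
  by (cases t rule: point_vec.cases) (simp_all add: vec_eq_iff forall_3)

lemma point_vec_on_matched_line: "vec.span {point_vec t} \<subseteq> normal_line (matched_normal t)"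
proof (rule vec.span_minimal)
  show "{point_vec t} \<subseteq> normal_line (matched_normal t)"
    by (cases t rule: point_vec.cases) (simp_all add: normal_line_def)
  show "vec.subspace (normal_line (matched_normal t))"
    using normal_line_in_proj_lines[OF matched_normal_nonzero] by (auto simp: proj_lines_def)
qed

text \<open>The first nonzero coordinate of every \<open>point_vec\<close> is 1, so proportional
  representatives are equal.\<close>

lemma inj_point_span: "inj (\<lambda>t. vec.span {point_vec t})"
proof (rule injI)
  fix s t :: "('f::field \<times> 'f) + 'f option"
  assume "vec.span {point_vec s} = vec.span {point_vec t}"
  then have "point_vec s \<in> vec.span {point_vec t}"
    by (metis insertI1 vec.span_base)
  then obtain k where "point_vec s = k *s point_vec t"
    by (auto simp: vec.span_singleton)
  then show "s = t"
    by (cases s rule: point_vec.cases; cases t rule: point_vec.cases)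
      (auto simp: vec_eq_iff forall_3)
qed

text \<open>The last nonzero coordinate is -1, except for the vector \<open>[1, 0, 0]\<close> of
  \<open>Inr None\<close>, so proportional normals are equal. The only possible clash,
  \<open>b - a * a = - (s * s)\<close> with \<open>a = s\<close>, would need \<open>b = 0\<close>,
  which the case split excludes.\<close>

lemma inj_matched_line: "inj (\<lambda>t. normal_line (matched_normal t))"
proof (rule injI)
  fix s t :: "('f::field \<times> 'f) + 'f option"
  assume "normal_line (matched_normal s) = normal_line (matched_normal t)"
  from normal_line_eqD[OF this] show "s = t"
    by (cases s rule: point_vec.cases; cases t rule: point_vec.cases)
      (auto split: if_splits)
qed

lemma ex_incident_labelling:
  assumes n: "n = CARD('f::{field,finite})\<^sup>2 + CARD('f) + 1"
  shows "\<exists>P L :: nat \<Rightarrow> ('f ^ 3) set. proj_labelling n P L \<and> incident_labelling n P L"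
proof -
  have "CARD(('f \<times> 'f) + 'f option) = n"
    by (simp add: n power2_eq_square card_sum card_option)
  then obtain e :: "nat \<Rightarrow> ('f \<times> 'f) + 'f option" where e: "bij_betw e {..<n} UNIV"
    using ex_bij_betw_nat_finite[of "UNIV :: (('f \<times> 'f) + 'f option) set"]
    by (auto simp: atLeast0LessThan)
  \<comment> \<open>An injection into a set of \<open>n\<close> elements is onto, so the counts of
    points and lines replace any proof that the coordinates reach all of them.\<close>
  have bij: "bij_betw (\<lambda>i. f (e i)) {..<n} T"
    if "inj f" "range f \<subseteq> T" "card T = n" for f and T :: "('f ^ 3) set set"
  proof -
    have inj: "inj_on (\<lambda>i. f (e i)) {..<n}"
      using e that(1) by (auto simp: inj_on_def bij_betw_def)
    moreover have "(\<lambda>i. f (e i)) ` {..<n} = T"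
      using that card_image[OF inj] by (intro card_subset_eq) auto
    ultimately show ?thesis
      by (simp add: bij_betw_def)
  qed
  define P where "P i = vec.span {point_vec (e i)}" for i
  define L where "L i = normal_line (matched_normal (e i))" for i
  have "bij_betw P {..<n} proj_points"
    unfolding P_def
    by (rule bij) (auto simp: inj_point_span n card_proj_points
        intro!: span_in_proj_points point_vec_nonzero simp del: vec.span_singleton)
  moreover have "bij_betw L {..<n} proj_lines"
    unfolding L_def
    by (rule bij) (auto simp: inj_matched_line n card_proj_lines
        intro!: normal_line_in_proj_lines matched_normal_nonzero)
  moreover have "incident_labelling n P L"
    using point_vec_on_matched_line
    by (auto simp: incident_labelling_def points_on_def P_def L_def)
  ultimately show ?thesis
    unfolding proj_labelling_def by blast
qed

section \<open>The projective distribution\<close>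

lemma card_points_on:
  fixes P L :: "nat \<Rightarrow> ('f::{field,finite} ^ 3) set"
  assumes "proj_labelling n P L" "k < n"
  shows "card (points_on n P L k) = CARD('f) + 1"
proof -
  have P: "bij_betw P {..<n} proj_points" and Lk: "L k \<in> proj_lines"
    using assms by (auto simp: proj_labelling_def bij_betw_def)
  have "bij_betw P (points_on n P L k) {U \<in> proj_points. U \<subseteq> L k}"
  proof (rule bij_betw_subset[OF P])
    show "P ` points_on n P L k = {U \<in> proj_points. U \<subseteq> L k}"
      unfolding points_on_def bij_betw_imp_surj_on[OF P, symmetric] by auto
  qed (auto simp: points_on_def)
  then show ?thesis
    using card_points_in_line[OF Lk] by (simp add: bij_betw_same_card)
qed

lemma unique_line_index:
  assumes "proj_labelling n P L" "i < n" "j < n" "i \<noteq> j"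
  shows "\<exists>!k. k < n \<and> i \<in> points_on n P L k \<and> j \<in> points_on n P L k"
proof -
  have P: "inj_on P {..<n}" "P ` {..<n} = proj_points"
    and L: "inj_on L {..<n}" "L ` {..<n} = proj_lines"
    using assms(1) by (auto simp: proj_labelling_def bij_betw_def)
  have "P i \<in> proj_points" "P j \<in> proj_points" "P i \<noteq> P j"
    using assms(2-4) P by (auto dest: inj_onD)
  from unique_line_through_points[OF this]
  obtain W where W: "W \<in> proj_lines" "P i \<subseteq> W" "P j \<subseteq> W"
    and uniq: "\<And>W'. W' \<in> proj_lines \<Longrightarrow> P i \<subseteq> W' \<Longrightarrow> P j \<subseteq> W' \<Longrightarrow> W' = W"
    by blast
  obtain k where k: "k < n" "W = L k"
    using W(1) unfolding L(2)[symmetric] by auto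
  show ?thesis
  proof (rule ex1I[of _ k])
    show "k < n \<and> i \<in> points_on n P L k \<and> j \<in> points_on n P L k"
      using k W assms by (simp add: points_on_def)
    fix k' assume k': "k' < n \<and> i \<in> points_on n P L k' \<and> j \<in> points_on n P L k'"
    then have "L k' = L k"
      using uniq[of "L k'"] L k by (auto simp: points_on_def)
    then show "k' = k"
      using L k k' by (auto dest: inj_onD)
  qed
qed

lemma weak_cartesian_projective_dist:
  fixes P L :: "nat \<Rightarrow> ('f::{field,finite} ^ 3) set"
  assumes n: "n = CARD('f)\<^sup>2 + CARD('f) + 1" and PL: "proj_labelling n P L"
  shows "weak_cartesian m n (projective_dist m n P L)"
  unfolding weak_cartesian_def
proof (intro conjI allI impI)
  fix k assume k: "k < n"
  let ?S = "points_on n P L k"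
  have "finite ?S"
    by (simp add: points_on_def)
  \<comment> \<open>What remains are the ordered pairs of distinct points of one line,
    \<open>(q + 1) * q = n - 1\<close> in number.\<close>
  moreover have "alloc (projective_dist m n P L) k - {(k, k)} = {(i, j). i \<in> ?S \<and> j \<in> ?S \<and> i \<noteq> j}"
    by (auto simp: projective_dist_def)
  ultimately show "card (alloc (projective_dist m n P L) k - {(k, k)}) = n - 1"
    using card_points_on[OF PL k] by (simp add: card_distinct_pairs n power2_eq_square)
next
  fix i j assume ij: "i < n" "j < n"
  show "\<exists>!k. k < n \<and> (i, j) \<in> alloc (projective_dist m n P L) k"
  proof (cases "i = j")
    case True
    then show ?thesis
      using ij by (auto simp: projective_dist_def)
  next
    case False
    then show ?thesis
      using unique_line_index[OF PL ij False] by (auto simp: projective_dist_def)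
  qed
qed (auto simp: projective_dist_def points_on_def)

lemma comm_projective_dist:
  fixes P L :: "nat \<Rightarrow> ('f::{field,finite} ^ 3) set"
  assumes PL: "proj_labelling n P L" and inc: "incident_labelling n P L" and k: "k < n"
  shows "comm (projective_dist m n P L) k = 2 * (CARD('f) + 1)"
proof -
  let ?S = "points_on n P L k"
  let ?A = "alloc (projective_dist m n P L) k"
  have kS: "k \<in> ?S"
    using inc k by (simp add: incident_labelling_def)
  have A: "?A = insert (k, k) {(i, j). i \<in> ?S \<and> j \<in> ?S \<and> i \<noteq> j}"
    by (simp add: projective_dist_def)
  \<comment> \<open>By incidence \<open>k\<close> is itself a point of the line: another point
    \<open>i\<close> occurs in the blocks \<open>(i, k)\<close> and \<open>(k, i)\<close>, and
    \<open>k\<close> in its diagonal block.\<close>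
  have "i \<in> fst ` ?A \<and> i \<in> snd ` ?A" if "i \<in> ?S" for i
    using that kS unfolding A by (cases "i = k") force+
  moreover have "fst ` ?A \<subseteq> ?S" "snd ` ?A \<subseteq> ?S"
    using kS unfolding A by auto
  ultimately have "fst ` ?A = ?S" "snd ` ?A = ?S"
    by blast+
  then show ?thesis
    using card_points_on[OF PL k] by (simp add: comm_def)
qed

section \<open>The lower bound for all weak Cartesian distributions\<close>

lemma add_ge_if_mult_gt:
  fixes r c q :: nat
  assumes "r * c > q * (q + 1)"
  shows "r + c \<ge> 2 * (q + 1)"
proof (rule ccontr)
  assume "\<not> ?thesis"
  \<comment> \<open>In the integers, where \<open>r - c\<close> may be negative,
    \<open>4 * r * c\<close> is at most the square of \<open>r + c\<close>, hence at most
    \<open>4 * q * (q + 1) + 1\<close>; but \<open>r * c > q * (q + 1)\<close> makes it at least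
    \<open>4 * q * (q + 1) + 4\<close>.\<close>
  then have "int r + int c \<le> 2 * int q + 1" by simp
  then have "(int r + int c)\<^sup>2 \<le> (2 * int q + 1)\<^sup>2"
    by (intro power_mono) auto
  moreover have "4 * (int r * int c) \<le> (int r + int c)\<^sup>2"
    using zero_le_power2[of "int r - int c"] by (simp add: power2_eq_square algebra_simps)
  moreover have "int r * int c > int q * (int q + 1)"
    using assms by (metis of_nat_1 of_nat_add of_nat_less_iff of_nat_mult)
  ultimately show False
    by (simp add: power2_eq_square algebra_simps)
qed

lemma weak_cartesian_comm_ge:
  assumes "weak_cartesian m n d" "k < n" and n: "n = q\<^sup>2 + q + 1"
  shows "comm d k \<ge> 2 * (q + 1)"
proof -
  let ?A = "alloc d k"
  have sub: "?A \<subseteq> {..<n} \<times> {..<n}" and diag: "(k, k) \<in> ?A"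
    and card: "card (?A - {(k, k)}) = n - 1"
    using assms by (auto simp: weak_cartesian_def)
  have fin: "finite ?A"
    using sub finite_subset by blast
  have "card ?A = n"
    using card card_Suc_Diff1[OF fin diag] assms(2) by simp
  moreover have "card ?A \<le> card (fst ` ?A \<times> snd ` ?A)"
    using fin by (intro card_mono) (auto intro: rev_image_eqI)
  ultimately have "card (fst ` ?A) * card (snd ` ?A) > q * (q + 1)"
    by (simp add: card_cartesian_product n power2_eq_square)
  then show ?thesis
    unfolding comm_def by (rule add_ge_if_mult_gt)
qed

theorem theorem1:
  fixes m n p :: nat
  assumes "primepow p"
    and "CARD('f::{field,finite}) = p"
    and "n = p\<^sup>2 + p + 1"
  shows "(\<exists>P L :: nat \<Rightarrow> ('f ^ 3) set.
            proj_labelling n P L \<and> incident_labelling n P L) \<and>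
         (\<forall>P L :: nat \<Rightarrow> ('f ^ 3) set. proj_labelling n P L \<longrightarrow>
            weak_cartesian m n (projective_dist m n P L) \<and>
            (incident_labelling n P L \<longrightarrow> min_comm m n (projective_dist m n P L)))"
proof -
  have n: "n = CARD('f)\<^sup>2 + CARD('f) + 1"
    using assms by simp
  show ?thesis
  proof (intro conjI allI impI)
    show "\<exists>P L :: nat \<Rightarrow> ('f ^ 3) set. proj_labelling n P L \<and> incident_labelling n P L"
      using n by (rule ex_incident_labelling)
  next
    fix P L :: "nat \<Rightarrow> ('f ^ 3) set"
    assume PL: "proj_labelling n P L"
    show "weak_cartesian m n (projective_dist m n P L)"
      using n PL by (rule weak_cartesian_projective_dist)
    assume "incident_labelling n P L"
    then show "min_comm m n (projective_dist m n P L)"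
      \<comment> \<open>The common value at all processes of the projective distribution equals the
        lower bound at every process of any competitor.\<close>
      using comm_projective_dist[OF PL] weak_cartesian_comm_ge[OF _ _ n]
      by (simp add: min_comm_def)
  qed
qed

end
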